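(* Suppose that $\mathcal{A}\subseteq[\mathbb{N}]^\omega$ is an uncountable, almost disjoint family such that every bounded linear operator $T\colon C_0(K_{\mathcal{A}})\to C_0(K_{\mathcal{A}})$ is of the form $T=\lambda\,\mathrm{Id}+S$ for some scalar $\lambda\in\mathbb{K}$ and some operator $S\colon C_0(K_{\mathcal{A}})\to C_0(K_{\mathcal{A}})$ that factors through $c_0$. Then, for every continuous map $\phi\colon\alpha K_{\mathcal{A}}\to\alpha K_{\mathcal{A}}$, either $\phi$ has countable range or the set of fixed points of $\phi$ is cocountable (i.e., has countable complement in $\alpha K_{\mathcal{A}}$).
   Context: $\mathbb{N}=\{0,1,2,\ldots\}$; $[\mathbb{N}]^\omega$ and $[\mathbb{N}]^{<\omega}$ denote the families of all infinite, respectively finite, subsets of $\mathbb{N}$. A family $\mathcal{A}\subseteq[\mathbb{N}]^\omega$ is almost disjoint if $A\cap A'$ is finite whenever $A,A'\in\mathcal{A}$ are distinct. The scalar field $\mathbb{K}$ is $\mathbb{R}$ or $\mathbb{C}$. For an almost disjoint family $\mathcal{A}$, $K_{\mathcal{A}}$ is the (locally compact, scattered, Hausdorff) topological space consisting of distinct points $\{x_n:n\in\mathbb{N}\}\cup\{y_A:A\in\mathcal{A}\}$, where each $x_n$ is isolated and, for each $A\in\mathcal{A}$, the sets $U(A,F)=\{x_n:n\in A\setminus F\}\cup\{y_A\}$ for $F\in[\mathbb{N}]^{<\omega}$ form a neighbourhood basis at $y_A$. $\alpha K_{\mathcal{A}}$ denotes the one-point compactification of $K_{\mathcal{A}}$.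 For a locally compact Hausdorff space $K$, $C_0(K)$ is the Banach space of all continuous $f\colon K\to\mathbb{K}$ such that $\{x\in K:|f(x)|\ge\varepsilon\}$ is compact for each $\varepsilon>0$, with the supremum norm. An operator $S$ on a Banach space $\mathcal{X}$ factors through $c_0$ if $S=VU$ for some bounded linear operators $U\colon\mathcal{X}\to c_0$ and $V\colon c_0\to\mathcal{X}$. *)

theory Defs
  imports "HOL-Analysis.Analysis"
begin

definition almost_disjoint :: "nat set set \<Rightarrow> bool" where
  "almost_disjoint \<A> \<longleftrightarrow>
     (\<forall>A\<in>\<A>. infinite A) \<and> pairwise (\<lambda>A B. finite (A \<inter> B)) \<A>"

text \<open>In the space \<open>K\<^sub>\<A>\<close>, the isolated point \<open>x\<^sub>n\<close> is represented by \<^term>\<open>Inl n\<close>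
  and the point \<open>y\<^sub>A\<close> by \<^term>\<open>Inr A\<close>.\<close>

definition basic_nbhd :: "nat set \<Rightarrow> nat set \<Rightarrow> (nat + nat set) set" where
  "basic_nbhd A F = insert (Inr A) (Inl ` (A - F))"

definition K_space :: "nat set set \<Rightarrow> (nat + nat set) topology" where
  "K_space \<A> = topology (\<lambda>U. U \<subseteq> range Inl \<union> Inr ` \<A> \<and>
     (\<forall>A. Inr A \<in> U \<longrightarrow> (\<exists>F. finite F \<and> basic_nbhd A F \<subseteq> U)))"

lemma openin_K_space:
  "openin (K_space \<A>) U \<longleftrightarrow> U \<subseteq> range Inl \<union> Inr ` \<A> \<and>
     (\<forall>A. Inr A \<in> U \<longrightarrow> (\<exists>F. finite F \<and> basic_nbhd A F \<subseteq> U))"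
proof -
  have "istopology (\<lambda>U. U \<subseteq> range Inl \<union> Inr ` \<A> \<and>
     (\<forall>A. Inr A \<in> U \<longrightarrow> (\<exists>F. finite F \<and> basic_nbhd A F \<subseteq> U)))"
    (is "istopology ?L")
    unfolding istopology_def
  proof (intro conjI allI impI)
    fix S T assume S: "?L S" and T: "?L T"
    show "S \<inter> T \<subseteq> range Inl \<union> Inr ` \<A>" using S by blast
    fix A assume "Inr A \<in> S \<inter> T"
    then obtain F G where "finite F" "basic_nbhd A F \<subseteq> S" "finite G" "basic_nbhd A G \<subseteq> T"
      using S T by blast
    then have "finite (F \<union> G) \<and> basic_nbhd A (F \<union> G) \<subseteq> S \<inter> T"
      by (auto simp: basic_nbhd_def)
    then show "\<exists>F. finite F \<and> basic_nbhd A F \<subseteq> S \<inter> T" by blast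
  next
    fix \<K> assume K: "\<forall>S\<in>\<K>. ?L S"
    then show "\<Union>\<K> \<subseteq> range Inl \<union> Inr ` \<A>" by blast
    fix A assume "Inr A \<in> \<Union>\<K>"
    then obtain S where "S \<in> \<K>" "Inr A \<in> S" by blast
    with K obtain F where "finite F" "basic_nbhd A F \<subseteq> S" by blast
    with \<open>S \<in> \<K>\<close> show "\<exists>F. finite F \<and> basic_nbhd A F \<subseteq> \<Union>\<K>" by blast
  qed
  then show ?thesis by (simp add: K_space_def topology_inverse')
qed

lemma openin_K_space_singleton: "openin (K_space \<A>) {Inl n}"
  by (auto simp: openin_K_space)

lemma openin_K_space_basic_nbhd: "A \<in> \<A> \<Longrightarrow> finite F \<Longrightarrow> openin (K_space \<A>) (basic_nbhd A F)"
  by (auto simp: openin_K_space basic_nbhd_def)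

lemma topspace_K_space: "topspace (K_space \<A>) = range Inl \<union> Inr ` \<A>"
proof (rule antisym)
  show "topspace (K_space \<A>) \<subseteq> range Inl \<union> Inr ` \<A>"
    using openin_K_space openin_topspace by blast
  have "openin (K_space \<A>) (range Inl \<union> Inr ` \<A>)"
    by (auto simp: openin_K_space basic_nbhd_def)
  then show "range Inl \<union> Inr ` \<A> \<subseteq> topspace (K_space \<A>)"
    by (rule openin_subset)
qed

text \<open>A function on a space \<open>X\<close> is represented by its extension by zero off \<^term>\<open>topspace X\<close>.
  For the bounded functions below, the supremum over the whole type is therefore the
  supremum over \<^term>\<open>topspace X\<close>.\<close>

definition sup_norm :: "('a \<Rightarrow> 'k::real_normed_field) \<Rightarrow> real" where
  "sup_norm f = (SUP x. norm (f x))"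

definition C_0 :: "'a topology \<Rightarrow> ('a \<Rightarrow> 'k::real_normed_field) set" where
  "C_0 X = {f. continuous_map X euclidean f \<and>
               (\<forall>\<epsilon>>0. compactin X {x \<in> topspace X. norm (f x) \<ge> \<epsilon>}) \<and>
               (\<forall>x. x \<notin> topspace X \<longrightarrow> f x = 0)}"

definition c_0 :: "(nat \<Rightarrow> 'k::real_normed_field) set" where
  "c_0 = {f. f \<longlonglongrightarrow> 0}"

text \<open>Operators are only considered on their domain \<open>V\<close>; their values elsewhere are irrelevant.
  Linearity is over \<open>'k\<close>, not merely over the reals.\<close>

definition bounded_operator ::
  "('a \<Rightarrow> 'k::real_normed_field) set \<Rightarrow> ('b \<Rightarrow> 'k) set \<Rightarrow> (('a \<Rightarrow> 'k) \<Rightarrow> ('b \<Rightarrow> 'k)) \<Rightarrow> bool" where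
  "bounded_operator V W T \<longleftrightarrow>
     T \<in> V \<rightarrow> W \<and>
     (\<forall>f\<in>V. \<forall>g\<in>V. T (\<lambda>x. f x + g x) = (\<lambda>y. T f y + T g y)) \<and>
     (\<forall>c. \<forall>f\<in>V. T (\<lambda>x. c * f x) = (\<lambda>y. c * T f y)) \<and>
     (\<exists>B. \<forall>f\<in>V. sup_norm (T f) \<le> B * sup_norm f)"

definition factors_through_c_0 ::
  "('a \<Rightarrow> 'k::real_normed_field) set \<Rightarrow> (('a \<Rightarrow> 'k) \<Rightarrow> ('a \<Rightarrow> 'k)) \<Rightarrow> bool" where
  "factors_through_c_0 V S \<longleftrightarrow>
     (\<exists>U R. bounded_operator V c_0 U \<and> bounded_operator c_0 V R \<and> (\<forall>f\<in>V. S f = R (U f)))"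

definition all_operators_scalar_plus_c_0_factoring ::
  "'k::real_normed_field itself \<Rightarrow> 'a topology \<Rightarrow> bool" where
  "all_operators_scalar_plus_c_0_factoring _ X \<longleftrightarrow>
     (\<forall>T. bounded_operator (C_0 X :: ('a \<Rightarrow> 'k) set) (C_0 X) T \<longrightarrow>
        (\<exists>c S. factors_through_c_0 (C_0 X) S \<and>
               (\<forall>f\<in>C_0 X. T f = (\<lambda>x. c * f x + S f x))))"

end

theory Submission
  imports Defs
begin

text \<open>Write \<open>f\<^sup>~\<close> for the extension of \<open>f \<in> C\<^sub>0(K)\<close> by zero at \<open>\<infinity>\<close>, and apply the hypothesis to
  \<open>T f = f\<^sup>~ \<circ> \<phi> - f\<^sup>~(\<phi>(\<infinity>))\<close>, so that \<open>T = \<lambda> Id + S\<close>. Functions in \<open>C\<^sub>0(K)\<close> have countable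
  support, hence so have the images of the unit vectors of \<open>c\<^sub>0\<close>, and by density all functions in the
  range of \<open>S\<close> vanish off one countable set \<open>M\<close>. For \<open>x \<notin> M\<close> this says
  \<open>f\<^sup>~(\<phi>(x)) - f\<^sup>~(\<phi>(\<infinity>)) = \<lambda> f(x)\<close> for all \<open>f\<close>. Testing with indicators of compact clopen sets
  shows \<open>\<phi>(x) = \<phi>(\<infinity>)\<close> if \<open>\<lambda> = 0\<close>, and \<open>x \<in> {\<phi>(x), \<phi>(\<infinity>)}\<close> otherwise.\<close>

section \<open>Boundedness and the supremum norm\<close>

text \<open>The set where the norm is at least 1 is compact, so its image is bounded; at all other
  points, including those off the space, the norm is below 1. Only with this bound does
  \<open>sup_norm\<close> really dominate the values of \<open>f\<close>.\<close>

lemma C_0_bdd_above: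
  assumes "f \<in> C_0 X"
  shows "bdd_above (range (\<lambda>x. norm (f x)))"
proof -
  let ?K = "{x \<in> topspace X. norm (f x) \<ge> 1}"
  have "compactin euclidean (f ` ?K)"
    using assms by (intro image_compactin[where X = X]) (auto simp: C_0_def)
  then have "bounded (f ` ?K)"
    by (simp add: compact_imp_bounded)
  then obtain b where b: "\<And>x. x \<in> ?K \<Longrightarrow> norm (f x) \<le> b"
    by (auto simp: bounded_iff)
  have "norm (f x) \<le> max b 1" for x
    using b[of x] assms by (cases "x \<in> ?K") (auto simp: C_0_def)
  then show ?thesis
    by (auto intro!: bdd_aboveI)
qed

lemma norm_le_sup_norm: "f \<in> C_0 X \<Longrightarrow> norm (f x) \<le> sup_norm f"
  unfolding sup_norm_def by (rule cSUP_upper) (auto intro: C_0_bdd_above)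

lemma sup_norm_nonneg: "bdd_above (range (\<lambda>x. norm (f x))) \<Longrightarrow> 0 \<le> sup_norm f"
  unfolding sup_norm_def by (metis UNIV_I cSUP_upper norm_ge_zero order_trans)

section \<open>The operator induced by a self-map of the compactification\<close>

text \<open>Only open sets \<open>U\<close> containing 0 involve the point at infinity
  \<open>None\<close>. Such a \<open>U\<close> contains a ball of radius \<open>e\<close> around 0,
  so the points mapped outside \<open>U\<close> form a closed subset of the compact set where the
  norm is at least \<open>e\<close>; the preimage of \<open>U\<close> is thus a neighbourhood of
  \<open>None\<close>.\<close>

lemma continuous_map_case_option_C_0:
  fixes f :: "'a \<Rightarrow> 'k::real_normed_field"
  assumes "f \<in> C_0 X"
  shows "continuous_map (Alexandroff_compactification X) euclidean (case_option 0 f)"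
  unfolding continuous_map_def
proof (intro conjI allI impI)
  fix U :: "'k set" assume "openin euclidean U"
  then have U: "open U" by simp
  have cont: "continuous_map X euclidean f" using assms by (simp add: C_0_def)
  let ?P = "{z \<in> topspace (Alexandroff_compactification X). case_option 0 f z \<in> U}"
  show "openin (Alexandroff_compactification X) ?P"
  proof (cases "0 \<in> U")
    case False
    have "z \<in> ?P \<longleftrightarrow> z \<in> Some ` {x \<in> topspace X. f x \<in> U}" for z
      using False by (cases z) auto
    then have "?P = Some ` {x \<in> topspace X. f x \<in> U}"
      by (rule set_eqI)
    moreover have "openin X {x \<in> topspace X. f x \<in> U}"
      using U by (intro openin_continuous_map_preimage[OF cont]) simp
    ultimately show ?thesis
      by (simp only: openin_Alexandroff_compactification_image_Some)
  next
    case True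
    let ?C = "{x \<in> topspace X. f x \<in> - U}"
    obtain e where e: "e > 0" "ball 0 e \<subseteq> U"
      using U True by (meson open_contains_ball)
    have closed: "closedin X ?C"
      using closedin_continuous_map_preimage[OF cont, of "- U"] U by (simp add: closed_Compl)
    have "?C \<subseteq> {x \<in> topspace X. norm (f x) \<ge> e}"
    proof
      fix x assume x: "x \<in> ?C"
      then have "f x \<notin> ball 0 e" using e by blast
      with x show "x \<in> {x \<in> topspace X. norm (f x) \<ge> e}" by simp
    qed
    moreover have "compactin X {x \<in> topspace X. norm (f x) \<ge> e}"
      using assms e by (simp add: C_0_def)
    ultimately have compact: "compactin X ?C"
      by (rule closed_compactin[OF _ _ closed, rotated])
    have "z \<in> ?P \<longleftrightarrow> z \<in> insert None (Some ` (topspace X - ?C))" for z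
      using True by (cases z) auto
    then have "?P = insert None (Some ` (topspace X - ?C))"
      by (rule set_eqI)
    then show ?thesis
      unfolding openin_Alexandroff_compactification using closed compact by (intro disjI2 exI conjI)
  qed
qed auto

text \<open>Subtracting the value at \<open>None\<close> makes the function vanish at infinity,
  which a mere composition with \<phi> need not do. The value 0 off the space follows the convention
  for members of \<open>C_0\<close>.\<close>

definition composition_difference ::
  "'a topology \<Rightarrow> ('a option \<Rightarrow> 'a option) \<Rightarrow> ('a \<Rightarrow> 'k::real_normed_field) \<Rightarrow> 'a \<Rightarrow> 'k" where
  "composition_difference X \<phi> f x =
     (if x \<in> topspace X then case_option 0 f (\<phi> (Some x)) - case_option 0 f (\<phi> None) else 0)"

lemma composition_difference_in_C_0:
  fixes f :: "'a \<Rightarrow> 'k::real_normed_field"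
  assumes \<phi>: "continuous_map (Alexandroff_compactification X) (Alexandroff_compactification X) \<phi>"
    and f: "f \<in> C_0 X"
  shows "composition_difference X \<phi> f \<in> C_0 X"
proof -
  let ?\<alpha> = "Alexandroff_compactification X"
  define h where "h z = case_option 0 f (\<phi> z) - case_option 0 f (\<phi> None)" for z
  have "continuous_map ?\<alpha> euclidean (case_option 0 f \<circ> \<phi>)"
    using \<phi> continuous_map_case_option_C_0[OF f] by (rule continuous_map_compose)
  then have h: "continuous_map ?\<alpha> euclidean h"
    unfolding h_def by (intro continuous_map_diff) (auto simp: o_def)
  have eq: "composition_difference X \<phi> f x = (h \<circ> Some) x" if "x \<in> topspace X" for x
    using that by (simp add: composition_difference_def h_def)
  have "continuous_map X euclidean (h \<circ> Some)"
    using continuous_map_Some h by (rule continuous_map_compose)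
  then have "continuous_map X euclidean (composition_difference X \<phi> f)"
    by (rule continuous_map_eq) (simp add: eq)
  moreover have "compactin X {x \<in> topspace X. norm (composition_difference X \<phi> f x) \<ge> e}"
    if "e > 0" for e
  proof -
    let ?K = "{x \<in> topspace X. norm (composition_difference X \<phi> f x) \<ge> e}"
    \<comment> \<open>Since \<open>h None = 0 < e\<close>, the superlevel set of \<open>h\<close>
      misses \<open>None\<close> and is the image of \<open>?K\<close> under \<open>Some\<close>.
      Its closedness in the compactification forces \<open>?K\<close> to be compact in
      \<open>X\<close>.\<close>
    have "closed {w :: 'k. norm w \<ge> e}"
      by (intro closed_Collect_le continuous_intros)
    then have "closedin ?\<alpha> {z \<in> topspace ?\<alpha>. h z \<in> {w. norm w \<ge> e}}"
      by (intro closedin_continuous_map_preimage[OF h]) simp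
    also have "{z \<in> topspace ?\<alpha>. h z \<in> {w. norm w \<ge> e}} = Some ` ?K"
      using that by (auto simp: eq) (auto simp: h_def)
    finally show ?thesis by simp
  qed
  ultimately show ?thesis
    by (simp add: C_0_def composition_difference_def)
qed

lemma bounded_operator_composition_difference:
  assumes \<phi>: "continuous_map (Alexandroff_compactification X) (Alexandroff_compactification X) \<phi>"
  shows "bounded_operator (C_0 X) (C_0 X)
    (composition_difference X \<phi> :: ('a \<Rightarrow> 'k::real_normed_field) \<Rightarrow> _)"
proof -
  \<comment> \<open>The constant 2 counts the two evaluations of the extended function, each bounded
    by \<open>sup_norm f\<close>.\<close>
  have "sup_norm (composition_difference X \<phi> f) \<le> 2 * sup_norm f"
    if f: "f \<in> C_0 X" for f :: "'a \<Rightarrow> 'k"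
  proof -
    have le: "norm (case_option 0 f z) \<le> sup_norm f" for z
      using norm_le_sup_norm[OF f] sup_norm_nonneg[OF C_0_bdd_above[OF f]]
      by (cases z) auto
    have "norm (composition_difference X \<phi> f x) \<le> 2 * sup_norm f" for x
      using norm_triangle_ineq4[of "case_option 0 f (\<phi> (Some x))" "case_option 0 f (\<phi> None)"]
        le[of "\<phi> (Some x)"] le[of "\<phi> None"] sup_norm_nonneg[OF C_0_bdd_above[OF f]]
      by (auto simp: composition_difference_def)
    then show ?thesis
      unfolding sup_norm_def[of "composition_difference X \<phi> f"] by (intro cSUP_least) auto
  qed
  moreover have "composition_difference X \<phi> (\<lambda>x. f x + g x) =
      (\<lambda>x. composition_difference X \<phi> f x + composition_difference X \<phi> g x)"
    for f g :: "'a \<Rightarrow> 'k"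
    by (auto simp: composition_difference_def fun_eq_iff split: option.splits)
  moreover have "composition_difference X \<phi> (\<lambda>x. c * f x) =
      (\<lambda>x. c * composition_difference X \<phi> f x)" for c and f :: "'a \<Rightarrow> 'k"
    by (auto simp: composition_difference_def fun_eq_iff algebra_simps split: option.splits)
  ultimately show ?thesis
    unfolding bounded_operator_def using composition_difference_in_C_0[OF \<phi>] by blast
qed

section \<open>Ranges of operators defined on \<open>c_0\<close>\<close>

text \<open>A single \<open>M\<close> serves all \<open>u\<close> because there are only countably
  many unit vectors and their span is dense: if every \<open>R (e n)\<close> vanishes at
  \<open>x\<close>, so does \<open>R u\<close>, as evaluation at \<open>x\<close> after
  \<open>R\<close> is linear and bounded.\<close>

lemma bounded_operator_c_0_range_countable_support:
  fixes R :: "(nat \<Rightarrow> 'k::real_normed_field) \<Rightarrow> 'a \<Rightarrow> 'k"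
  assumes R: "bounded_operator c_0 (C_0 X) R"
    and supp: "\<And>f :: 'a \<Rightarrow> 'k. f \<in> C_0 X \<Longrightarrow> countable {x. f x \<noteq> 0}"
  obtains M where "countable M" "\<And>u x. u \<in> c_0 \<Longrightarrow> x \<notin> M \<Longrightarrow> R u x = 0"
proof
  define e :: "nat \<Rightarrow> nat \<Rightarrow> 'k" where "e n k = (if k = n then 1 else 0)" for n k
  define M where "M = (\<Union>n. {x. R (e n) x \<noteq> 0})"
  have zero: "u \<in> c_0" if "\<And>k. k \<ge> n \<Longrightarrow> u k = 0" for u :: "nat \<Rightarrow> 'k" and n
  proof -
    have "eventually (\<lambda>k. u k = 0) sequentially"
      using that unfolding eventually_sequentially by blast
    then show ?thesis
      by (simp add: c_0_def tendsto_eventually)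
  qed
  have e: "e n \<in> c_0" for n
    by (rule zero[of "Suc n"]) (auto simp: e_def)
  have in_C_0: "R u \<in> C_0 X" if "u \<in> c_0" for u
    using R that by (auto simp: bounded_operator_def)
  have add: "R (\<lambda>k. u k + v k) x = R u x + R v x" if "u \<in> c_0" "v \<in> c_0" for u v x
    using R that by (simp add: bounded_operator_def)
  have scale: "R (\<lambda>k. c * u k) x = c * R u x" if "u \<in> c_0" for c u x
    using R that by (simp add: bounded_operator_def)
  obtain B where B: "\<And>u. u \<in> c_0 \<Longrightarrow> sup_norm (R u) \<le> B * sup_norm u"
    using R unfolding bounded_operator_def by blast
  show "countable M"
    unfolding M_def using supp in_C_0 e by blast
  fix u :: "nat \<Rightarrow> 'k" and x assume u: "u \<in> c_0" and x: "x \<notin> M"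
  \<comment> \<open>The truncations of \<open>u\<close> are finite combinations of unit vectors and
    converge to \<open>u\<close> in norm.\<close>
  define t where "t n k = (if k < n then u k else 0)" for n k
  have t: "t n \<in> c_0" for n
    by (rule zero[of n]) (simp add: t_def)
  have R_t: "R (t n) x = 0" for n
  proof (induction n)
    case 0
    \<comment> \<open>Writing the zero sequence as a multiple of a unit vector lets homogeneity
      yield the value 0.\<close>
    have "t 0 = (\<lambda>k. 0 * e 0 k)" by (simp add: t_def fun_eq_iff)
    then show ?case using scale[OF e, of 0 0 x] by simp
  next
    case (Suc n)
    have scaled: "(\<lambda>k. u n * e n k) \<in> c_0"
      by (rule zero[of "Suc n"]) (auto simp: e_def)
    have "t (Suc n) = (\<lambda>k. t n k + u n * e n k)"
      by (auto simp: t_def e_def fun_eq_iff less_Suc_eq)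
    then have "R (t (Suc n)) x = R (t n) x + u n * R (e n) x"
      using add[OF t scaled] scale[OF e] by simp
    then show ?case
      using Suc x by (simp add: M_def)
  qed
  have "norm (R u x) \<le> \<bar>B\<bar> * \<epsilon>" if "\<epsilon> > 0" for \<epsilon>
  proof -
    have "eventually (\<lambda>k. norm (u k) < \<epsilon>) sequentially"
      using u that by (auto simp: c_0_def tendsto_iff)
    then obtain n where n: "\<And>k. k \<ge> n \<Longrightarrow> norm (u k) < \<epsilon>"
      by (auto simp: eventually_sequentially)
    \<comment> \<open>The tail of \<open>u\<close> from index \<open>n\<close> on: it has norm at
      most \<epsilon> and the same image as \<open>u\<close> at \<open>x\<close>.\<close>
    define v where "v k = u k - t n k" for k
    have v: "v \<in> c_0"
      using tendsto_diff[of u 0 sequentially "t n" 0] u t[of n]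
      by (simp add: c_0_def v_def[abs_def])
    have norm_v: "norm (v k) \<le> \<epsilon>" for k
      using n[of k] that by (cases "k < n") (simp_all add: v_def t_def)
    then have "0 \<le> sup_norm v"
      by (intro sup_norm_nonneg) (auto intro!: bdd_aboveI)
    moreover have "sup_norm v \<le> \<epsilon>"
      unfolding sup_norm_def using norm_v by (intro cSUP_least) auto
    \<comment> \<open>The absolute value appears because the bound \<open>B\<close> may be
      negative.\<close>
    ultimately have "B * sup_norm v \<le> \<bar>B\<bar> * \<epsilon>"
      by (intro mult_mono) auto
    moreover have "u = (\<lambda>k. t n k + v k)"
      by (simp add: v_def)
    then have "R u x = R v x"
      using add[OF t v, of n x] R_t by simp
    moreover have "norm (R v x) \<le> B * sup_norm v"
      using norm_le_sup_norm[OF in_C_0[OF v]] B[OF v] by (rule order_trans)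
    ultimately show ?thesis by simp
  qed
  note bound = this
  have "norm (R u x) \<le> \<delta>" if "\<delta> > 0" for \<delta>
  proof -
    \<comment> \<open>Adding 1 keeps the denominator positive even when
      \<open>B = 0\<close>.\<close>
    have "norm (R u x) \<le> \<bar>B\<bar> * (\<delta> / (\<bar>B\<bar> + 1))"
      by (rule bound) (use that in \<open>simp add: add_nonneg_pos\<close>)
    also have "\<dots> \<le> \<delta>"
      using that by (simp add: field_simps)
    finally show ?thesis .
  qed
  then have "norm (R u x) \<le> 0"
    using field_le_epsilon[of "norm (R u x)" 0] by simp
  then show "R u x = 0" by simp
qed

section \<open>Compact sets and supports in \<open>K_space\<close>\<close>

text \<open>Cover the space by the open set of isolated points and one full basic neighbourhood for
  each member of the family. Each covering set contains at most one point of the form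
  \<open>Inr A\<close>, so a finite subcover leaves room for only finitely many.\<close>

lemma compactin_K_space_finite_Inr:
  assumes "compactin (K_space \<A>) C"
  shows "finite (C \<inter> range Inr)"
proof -
  let ?\<U> = "insert (range Inl) ((\<lambda>A. basic_nbhd A {}) ` \<A>)"
  have "C \<subseteq> topspace (K_space \<A>)"
    using assms by (rule compactin_subset_topspace)
  then have "C \<subseteq> \<Union>?\<U>"
    by (auto simp: topspace_K_space basic_nbhd_def)
  moreover have "openin (K_space \<A>) U" if "U \<in> ?\<U>" for U
    using that openin_K_space_basic_nbhd by (auto simp: openin_K_space[of _ "range Inl"])
  ultimately obtain \<F> where \<F>: "finite \<F>" "\<F> \<subseteq> ?\<U>" "C \<subseteq> \<Union>\<F>"
    using assms compactinD[of "K_space \<A>" C ?\<U>] by blast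
  have "finite (U \<inter> range Inr)" if "U \<in> \<F>" for U
  proof -
    have "U = range Inl \<or> (\<exists>A. U = basic_nbhd A {})"
      using that \<F> by auto
    moreover have "range Inl \<inter> range Inr = ({} :: (nat + nat set) set)" by auto
    moreover have "basic_nbhd A {} \<inter> range Inr = {Inr A}" for A
      by (auto simp: basic_nbhd_def)
    ultimately show ?thesis by (metis finite.emptyI finite.insertI)
  qed
  then have "finite (\<Union>U\<in>\<F>. U \<inter> range Inr)"
    using \<F>(1) by (intro finite_UN_I)
  moreover have "C \<inter> range Inr \<subseteq> (\<Union>U\<in>\<F>. U \<inter> range Inr)"
    using \<F> by blast
  ultimately show ?thesis
    by (rule rev_finite_subset)
qed

text \<open>The isolated points are countable in number. Among the remaining points, the support is
  the union over \<open>n\<close> of the finite sets where the norm is at least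
  \<open>1 / real (Suc n)\<close>.\<close>

lemma countable_support_C_0_K_space:
  fixes f :: "nat + nat set \<Rightarrow> 'k::real_normed_field"
  assumes "f \<in> C_0 (K_space \<A>)"
  shows "countable {x. f x \<noteq> 0}"
proof -
  let ?K = "\<lambda>n. {x \<in> topspace (K_space \<A>). norm (f x) \<ge> 1 / real (Suc n)}"
  have "finite (?K n \<inter> range Inr)" for n
  proof (rule compactin_K_space_finite_Inr)
    show "compactin (K_space \<A>) (?K n)"
      using assms unfolding C_0_def by fastforce
  qed
  then have "countable (\<Union>n. ?K n \<inter> range Inr)"
    by (intro countable_UN countableI_type countable_finite)
  then have "countable (range Inl \<union> (\<Union>n. ?K n \<inter> range Inr))"
    by (intro countable_Un countable_image countableI_type)
  moreover have "{x. f x \<noteq> 0} \<subseteq> range Inl \<union> (\<Union>n. ?K n \<inter> range Inr)"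
  proof
    fix x assume "x \<in> {x. f x \<noteq> 0}"
    then have x: "norm (f x) > 0" "x \<in> topspace (K_space \<A>)"
      using assms by (auto simp: C_0_def)
    then obtain n where "1 / real (Suc n) < norm (f x)"
      using nat_approx_posE by blast
    then have "x \<in> ?K n"
      using x by simp
    then show "x \<in> range Inl \<union> (\<Union>n. ?K n \<inter> range Inr)"
      by (cases x) blast+
  qed
  ultimately show ?thesis
    by (rule countable_subset[rotated])
qed

section \<open>Compact clopen sets and separating functions\<close>

lemma indicator_in_C_0:
  assumes "openin X C" "closedin X C" "compactin X C"
  shows "(\<lambda>x. if x \<in> C then 1 else 0 :: 'k::real_normed_field) \<in> C_0 X"
proof -
  have sub: "C \<subseteq> topspace X"
    using assms(1) by (rule openin_subset)
  have "openin X {x \<in> topspace X. (if x \<in> C then 1 else 0 :: 'k) \<in> U}" for U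
  proof -
    have "{x \<in> topspace X. (if x \<in> C then 1 else 0 :: 'k) \<in> U} =
        (if 1 \<in> U then C else {}) \<union> (if 0 \<in> U then topspace X - C else {})"
      using sub by auto
    moreover have "openin X (if 1 \<in> U then C else {})" "openin X (if 0 \<in> U then topspace X - C else {})"
      using assms by (simp_all add: openin_diff)
    ultimately show ?thesis
      by (simp only: openin_Un)
  qed
  moreover have "compactin X {x \<in> topspace X. norm (if x \<in> C then 1 else 0 :: 'k) \<ge> e}"
    if "e > 0" for e
  proof -
    have "{x \<in> topspace X. norm (if x \<in> C then 1 else 0 :: 'k) \<ge> e} = (if e \<le> 1 then C else {})"
      using sub that by auto
    then show ?thesis using assms by simp
  qed
  ultimately show ?thesis
    using sub by (auto simp: C_0_def continuous_map_def)
qed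

text \<open>Almost disjointness enters here: for \<open>B\<close> in the family other than
  \<open>A\<close>, deleting the finite set \<open>B \<inter> A\<close> from \<open>B\<close> leaves
  a basic neighbourhood of \<open>Inr B\<close> disjoint from that of \<open>Inr A\<close>.\<close>

lemma closedin_K_space_basic_nbhd:
  assumes "almost_disjoint \<A>" "A \<in> \<A>"
  shows "closedin (K_space \<A>) (basic_nbhd A F)"
  unfolding closedin_def
proof
  show "basic_nbhd A F \<subseteq> topspace (K_space \<A>)"
    using assms by (auto simp: topspace_K_space basic_nbhd_def)
  have "\<exists>G. finite G \<and> basic_nbhd B G \<subseteq> topspace (K_space \<A>) - basic_nbhd A F"
    if B: "Inr B \<in> topspace (K_space \<A>) - basic_nbhd A F" for B
  proof (intro exI conjI)
    have "B \<in> \<A>" "B \<noteq> A"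
      using B by (auto simp: topspace_K_space basic_nbhd_def)
    then show "finite (B \<inter> A)"
      using assms by (auto simp: almost_disjoint_def pairwise_def)
    show "basic_nbhd B (B \<inter> A) \<subseteq> topspace (K_space \<A>) - basic_nbhd A F"
      using \<open>B \<in> \<A>\<close> \<open>B \<noteq> A\<close> by (auto simp: topspace_K_space basic_nbhd_def)
  qed
  then show "openin (K_space \<A>) (topspace (K_space \<A>) - basic_nbhd A F)"
    unfolding openin_K_space by (auto simp: topspace_K_space)
qed

text \<open>An open set containing \<open>Inr A\<close> already covers all but finitely many points
  of the neighbourhood; each leftover point, collected in \<open>?D\<close>, needs one more member
  of the cover.\<close>

lemma compactin_K_space_basic_nbhd:
  assumes "A \<in> \<A>"
  shows "compactin (K_space \<A>) (basic_nbhd A F)"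
  unfolding compactin_def
proof (intro conjI allI impI)
  show "basic_nbhd A F \<subseteq> topspace (K_space \<A>)"
    using assms by (auto simp: topspace_K_space basic_nbhd_def)
  fix \<U> assume \<U>: "(\<forall>U\<in>\<U>. openin (K_space \<A>) U) \<and> basic_nbhd A F \<subseteq> \<Union>\<U>"
  then obtain U where U: "U \<in> \<U>" "Inr A \<in> U"
    by (auto simp: basic_nbhd_def)
  with \<U> have "openin (K_space \<A>) U" by blast
  with U obtain G where G: "finite G" "basic_nbhd A G \<subseteq> U"
    unfolding openin_K_space by blast
  let ?D = "basic_nbhd A F \<inter> Inl ` G"
  have "\<forall>x\<in>?D. \<exists>V\<in>\<U>. x \<in> V"
    using \<U> by blast
  then obtain V where V: "\<And>x. x \<in> ?D \<Longrightarrow> V x \<in> \<U> \<and> x \<in> V x"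
    by metis
  show "\<exists>\<F>. finite \<F> \<and> \<F> \<subseteq> \<U> \<and> basic_nbhd A F \<subseteq> \<Union>\<F>"
  proof (intro exI conjI)
    show "finite (insert U (V ` ?D))" using G by simp
    show "insert U (V ` ?D) \<subseteq> \<U>" using U V by blast
    have "x \<in> U \<or> x \<in> ?D" if "x \<in> basic_nbhd A F" for x
      using that G by (auto simp: basic_nbhd_def)
    then show "basic_nbhd A F \<subseteq> \<Union>(insert U (V ` ?D))"
      using V by blast
  qed
qed

text \<open>The function is the indicator of a compact clopen set around \<open>x\<close> that
  avoids \<open>Q\<close>. Taking \<open>Q\<close> in the compactification allows the point at
  infinity among the points to avoid; there the extended function is 0 anyway.\<close>

lemma C_0_K_space_separates:
  assumes "almost_disjoint \<A>" "x \<in> topspace (K_space \<A>)" "finite Q" "Some x \<notin> Q"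
  obtains f :: "nat + nat set \<Rightarrow> 'k::real_normed_field"
  where "f \<in> C_0 (K_space \<A>)" "f x = 1" "\<And>q. q \<in> Q \<Longrightarrow> case_option 0 f q = 0"
proof -
  have "\<exists>C. openin (K_space \<A>) C \<and> closedin (K_space \<A>) C \<and> compactin (K_space \<A>) C \<and>
      x \<in> C \<and> Some ` C \<inter> Q = {}"
  proof (cases x)
    case (Inl n)
    have "closedin (K_space \<A>) {Inl n}"
      unfolding closedin_def
    proof
      show "{Inl n} \<subseteq> topspace (K_space \<A>)" by (simp add: topspace_K_space)
      show "openin (K_space \<A>) (topspace (K_space \<A>) - {Inl n})"
        unfolding openin_K_space topspace_K_space
      proof (intro conjI allI impI)
        fix A
        assume "Inr A \<in> range Inl \<union> Inr ` \<A> - {Inl n}"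
        then have "finite {n} \<and> basic_nbhd A {n} \<subseteq> range Inl \<union> Inr ` \<A> - {Inl n}"
          by (auto simp: basic_nbhd_def)
        then show "\<exists>F. finite F \<and> basic_nbhd A F \<subseteq> range Inl \<union> Inr ` \<A> - {Inl n}" ..
      qed blast
    qed
    moreover have "compactin (K_space \<A>) {Inl n}"
      by (rule finite_imp_compactin) (auto simp: topspace_K_space)
    moreover have "x \<in> {Inl n} \<and> Some ` {Inl n} \<inter> Q = {}"
      using Inl assms(4) by simp
    ultimately show ?thesis
      using openin_K_space_singleton by blast
  next
    case (Inr A)
    then have A: "A \<in> \<A>"
      using assms by (auto simp: topspace_K_space)
    \<comment> \<open>Removing these indices suffices, since the only non-isolated point of the
      neighbourhood is \<open>x\<close> itself. Finiteness of \<open>F\<close> comes from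
      injectivity of the embedding of the indices.\<close>
    define F where "F = {n. Some (Inl n) \<in> Q}"
    define N where "N = basic_nbhd A F"
    have "finite F"
      unfolding F_def using finite_vimageI[OF assms(3), of "\<lambda>n. Some (Inl n)"]
      by (simp add: vimage_def inj_on_def)
    then have "openin (K_space \<A>) N"
      unfolding N_def by (rule openin_K_space_basic_nbhd[OF A])
    moreover have "x \<in> N \<and> Some ` N \<inter> Q = {}"
      using Inr assms by (auto simp: N_def basic_nbhd_def F_def)
    moreover have "closedin (K_space \<A>) N" "compactin (K_space \<A>) N"
      unfolding N_def
      by (rule closedin_K_space_basic_nbhd[OF assms(1) A] compactin_K_space_basic_nbhd[OF A])+
    ultimately show ?thesis by blast
  qed
  then obtain C where C: "openin (K_space \<A>) C" "closedin (K_space \<A>) C"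
      "compactin (K_space \<A>) C" "x \<in> C" "Some ` C \<inter> Q = {}"
    by blast
  show ?thesis
  proof (rule that[OF indicator_in_C_0[OF C(1-3)]])
    show "case_option 0 (\<lambda>x. if x \<in> C then 1 else 0) q = (0 :: 'k)" if "q \<in> Q" for q
      using that C(5) by (cases q) auto
  qed (use C in simp)
qed

section \<open>The dichotomy for self-maps, uniformly in the scalar field\<close>

lemma self_maps_dichotomy:
  assumes ad: "almost_disjoint \<A>"
    and ops: "all_operators_scalar_plus_c_0_factoring TYPE('k::real_normed_field) (K_space \<A>)"
    and \<phi>: "continuous_map (Alexandroff_compactification (K_space \<A>))
      (Alexandroff_compactification (K_space \<A>)) \<phi>"
  defines "\<alpha>K \<equiv> Alexandroff_compactification (K_space \<A>)"
  shows "countable (\<phi> ` topspace \<alpha>K) \<or>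
         countable (topspace \<alpha>K - {x \<in> topspace \<alpha>K. \<phi> x = x})"
proof -
  let ?X = "K_space \<A>"
  have top: "topspace \<alpha>K = insert None (Some ` topspace ?X)"
    by (simp add: \<alpha>K_def)
  have range: "\<phi> z \<in> insert None (Some ` topspace ?X)" if "z \<in> topspace \<alpha>K" for z
    using continuous_map_funspace[OF \<phi>] that by (auto simp: \<alpha>K_def)
  obtain c :: 'k and S where S: "factors_through_c_0 (C_0 ?X) S"
    and T: "\<And>f. f \<in> C_0 ?X \<Longrightarrow> composition_difference ?X \<phi> f = (\<lambda>x. c * f x + S f x)"
    using ops bounded_operator_composition_difference[OF \<phi>]
    unfolding all_operators_scalar_plus_c_0_factoring_def by blast
  obtain U R where U: "bounded_operator (C_0 ?X) c_0 U" and R: "bounded_operator c_0 (C_0 ?X) R"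
    and RU: "\<And>f. f \<in> C_0 ?X \<Longrightarrow> S f = R (U f)"
    using S unfolding factors_through_c_0_def by blast
  obtain M where M: "countable M" "\<And>u x. u \<in> c_0 \<Longrightarrow> x \<notin> M \<Longrightarrow> R u x = 0"
    by (rule bounded_operator_c_0_range_countable_support[OF R])
      (rule countable_support_C_0_K_space, assumption, blast)
  \<comment> \<open>Off \<open>M\<close> the summand factoring through \<open>c_0\<close>
    contributes nothing, leaving a pointwise identity valid for all \<open>f\<close> at
    once.\<close>
  have key: "case_option 0 f (\<phi> (Some x)) - case_option 0 f (\<phi> None) = c * f x"
    if "f \<in> C_0 ?X" "x \<in> topspace ?X" "x \<notin> M" for f x
  proof -
    have "U f \<in> c_0"
      using U that by (auto simp: bounded_operator_def)
    then have "S f x = 0"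
      using RU M that by simp
    then show ?thesis
      using fun_cong[OF T[OF that(1)], of x] that by (simp add: composition_difference_def)
  qed
  show ?thesis
  proof (cases "c = 0")
    case True
    have "\<phi> (Some x) = \<phi> None" if x: "x \<in> topspace ?X" "x \<notin> M" for x
    proof (rule ccontr)
      assume ne: "\<phi> (Some x) \<noteq> \<phi> None"
      have eq: "case_option 0 f (\<phi> (Some x)) = case_option 0 f (\<phi> None)"
        if "f \<in> C_0 ?X" for f :: "nat + nat set \<Rightarrow> 'k"
        using key[OF that x] True by simp
      \<comment> \<open>Of two distinct points at least one is not at infinity; call it
        \<open>p\<close>. A function equal to 1 at \<open>p\<close> and 0 at \<open>q\<close> then
        contradicts \<open>eq\<close>, whichever image \<open>p\<close> is.\<close>
      obtain p q where p: "p \<in> topspace ?X" and pq: "{Some p, q} = {\<phi> (Some x), \<phi> None}"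
        "Some p \<noteq> q"
        using ne range[of "Some x"] range[of None] x
        by (cases "\<phi> (Some x)") (auto simp: top insert_commute)
      have fin: "finite {q}" and notin: "Some p \<notin> {q}"
        using pq(2) by auto
      obtain f :: "nat + nat set \<Rightarrow> 'k" where f: "f \<in> C_0 ?X" "f p = 1"
        "\<And>z. z \<in> {q} \<Longrightarrow> case_option 0 f z = 0"
        using C_0_K_space_separates[OF ad p fin notin] by blast
      have "case_option 0 f (Some p) = 1" "case_option 0 f q = 0"
        using f(2,3) by simp_all
      then show False
        using eq[OF f(1)] pq(1) unfolding doubleton_eq_iff by (metis zero_neq_one)
    qed
    then have "\<phi> ` topspace \<alpha>K \<subseteq> insert (\<phi> None) ((\<phi> \<circ> Some) ` M)"
      by (auto simp: top)
    moreover have "countable (insert (\<phi> None) ((\<phi> \<circ> Some) ` M))"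
      using M(1) by simp
    ultimately show ?thesis
      using countable_subset by blast
  next
    case False
    \<comment> \<open>Otherwise a function with value 1 at \<open>x\<close> and 0 at both image
      points turns \<open>key\<close> into \<open>0 = c\<close>.\<close>
    have "\<phi> (Some x) = Some x \<or> \<phi> None = Some x" if x: "x \<in> topspace ?X" "x \<notin> M" for x
    proof (rule ccontr)
      assume "\<not> ?thesis"
      then have fin: "finite {\<phi> (Some x), \<phi> None}" and notin: "Some x \<notin> {\<phi> (Some x), \<phi> None}"
        by auto
      obtain f :: "nat + nat set \<Rightarrow> 'k" where f: "f \<in> C_0 ?X" "f x = 1"
        "\<And>z. z \<in> {\<phi> (Some x), \<phi> None} \<Longrightarrow> case_option 0 f z = 0"
        using C_0_K_space_separates[OF ad x(1) fin notin] by blast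
      then show False
        using key[OF f(1) x] False by simp
    qed
    \<comment> \<open>The second alternative can hold for at most one \<open>x\<close>, so it adds
      just the point \<open>\<phi> None\<close> to the exceptional set.\<close>
    then have "topspace \<alpha>K - {x \<in> topspace \<alpha>K. \<phi> x = x} \<subseteq> insert None (insert (\<phi> None) (Some ` M))"
      unfolding top by fastforce
    moreover have "countable (insert None (insert (\<phi> None) (Some ` M)))"
      using M(1) by simp
    ultimately show ?thesis
      using countable_subset by blast
  qed
qed

theorem proposition36:
  fixes \<A> :: "nat set set"
    and \<phi> :: "(nat + nat set) option \<Rightarrow> (nat + nat set) option"
  defines "\<alpha>K \<equiv> Alexandroff_compactification (K_space \<A>)"
  assumes "almost_disjoint \<A>"
    and "uncountable \<A>"
    and "all_operators_scalar_plus_c_0_factoring TYPE(real) (K_space \<A>) \<or>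
         all_operators_scalar_plus_c_0_factoring TYPE(complex) (K_space \<A>)"
    and "continuous_map \<alpha>K \<alpha>K \<phi>"
  shows "countable (\<phi> ` topspace \<alpha>K) \<or>
         countable (topspace \<alpha>K - {x \<in> topspace \<alpha>K. \<phi> x = x})"
  using assms(4)
proof
  assume "all_operators_scalar_plus_c_0_factoring TYPE(real) (K_space \<A>)"
  from self_maps_dichotomy[OF assms(2) this assms(5)[unfolded \<alpha>K_def]]
  show ?thesis unfolding \<alpha>K_def .
next
  assume "all_operators_scalar_plus_c_0_factoring TYPE(complex) (K_space \<A>)"
  from self_maps_dichotomy[OF assms(2) this assms(5)[unfolded \<alpha>K_def]]
  show ?thesis unfolding \<alpha>K_def .
qed

end
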